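(* If $G$ is a $C$-expander for some $C\ge3$ and $|V(G)|$ is even, then $G$ contains a perfect matching.
   Context: For a graph $G$ and $X\subseteq V(G)$, $N(X)$ denotes the set of vertices in $V(G)\setminus X$ that have a neighbour in $X$. An $n$-vertex graph $G$ is a $C$-expander if (a) $|N(X)|\ge C|X|$ for every $X\subseteq V(G)$ with $1\le|X|\le\frac{n}{2C}$, and (b) for any two disjoint vertex sets each of size at least $\frac{n}{2C}$ there is an edge of $G$ between them. *)

theory Defs
  imports Complex_Main "Graph_Theory.Digraph"
begin

text \<open>
  Finite simple undirected graphs are the locale \<^locale>\<open>graph\<close>: finite, loopfree digraphs
  without parallel arcs whose arc relation is symmetric. An undirected edge is thus a pair
  of opposite arcs, represented below by the two-element set of its ends.
\<close>

definition edges :: "('a, 'b) pre_digraph \<Rightarrow> 'a set set" where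
  "edges G = {{u, v} | u v. u \<rightarrow>\<^bsub>G\<^esub> v}"

definition neighbourhood :: "('a, 'b) pre_digraph \<Rightarrow> 'a set \<Rightarrow> 'a set" where
  "neighbourhood G X = {v \<in> verts G - X. \<exists>u\<in>X. {u, v} \<in> edges G}"

definition expander :: "real \<Rightarrow> ('a, 'b) pre_digraph \<Rightarrow> bool" where
  "expander C G \<longleftrightarrow>
     (\<forall>X \<subseteq> verts G. 1 \<le> card X \<and> real (card X) \<le> real (card (verts G)) / (2 * C) \<longrightarrow>
        real (card (neighbourhood G X)) \<ge> C * real (card X)) \<and>
     (\<forall>A \<subseteq> verts G. \<forall>B \<subseteq> verts G. A \<inter> B = {} \<and>
        real (card A) \<ge> real (card (verts G)) / (2 * C) \<and>
        real (card B) \<ge> real (card (verts G)) / (2 * C) \<longrightarrow>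
        (\<exists>a\<in>A. \<exists>b\<in>B. {a, b} \<in> edges G))"

definition matching :: "('a, 'b) pre_digraph \<Rightarrow> 'a set set \<Rightarrow> bool" where
  "matching G M \<longleftrightarrow> M \<subseteq> edges G \<and> (\<forall>e\<in>M. \<forall>f\<in>M. e \<noteq> f \<longrightarrow> e \<inter> f = {})"

definition perfect_matching :: "('a, 'b) pre_digraph \<Rightarrow> 'a set set \<Rightarrow> bool" where
  "perfect_matching G M \<longleftrightarrow> matching G M \<and> (\<forall>v\<in>verts G. \<exists>e\<in>M. v \<in> e)"

end

theory Submission
  imports Defs "HOL-Library.Disjoint_Sets"
begin

text \<open>
  Choose \<open>S\<close> maximal such that deleting \<open>S\<close> lowers the matching number by \<open>|S|\<close>, and let
  \<open>W = V - S\<close>. Then every vertex of \<open>W\<close> is missed by some maximum matching of \<open>W\<close>, and by the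
  exchange argument of Gallai's lemma the relation ``no maximum matching of \<open>W\<close> misses both \<open>u\<close>
  and \<open>v\<close>'' is transitive. Adjacent vertices are related, so its classes span no edges between
  each other, and the vertices missed by one maximum matching lie in distinct classes. Without a
  perfect matching of \<open>V\<close>, parity yields at least \<open>|S| + 2\<close> classes. Expansion
  forbids this: if some class is large, the union of the others is small and has all its
  neighbours in \<open>S\<close>; if none is, then \<open>|W| < 3n/(2C) \<le> n/2 < |S|\<close>,
  although each class has at least one vertex.
\<close>

section \<open>Maximum matchings\<close>

text \<open>Matchings covering only vertices of \<open>W\<close> stand in for matchings of the
  induced subgraph on \<open>W\<close>, so vertices can be deleted while \<open>G\<close> stays
  fixed.\<close>

definition matching_within :: "('a, 'b) pre_digraph \<Rightarrow> 'a set \<Rightarrow> 'a set set \<Rightarrow> bool" where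
  "matching_within G W M \<longleftrightarrow> matching G M \<and> \<Union>M \<subseteq> W"

definition max_matching :: "('a, 'b) pre_digraph \<Rightarrow> 'a set \<Rightarrow> 'a set set \<Rightarrow> bool" where
  "max_matching G W M \<longleftrightarrow>
     matching_within G W M \<and> (\<forall>N. matching_within G W N \<longrightarrow> card N \<le> card M)"

text \<open>The disjunct \<open>u = v\<close> supplies reflexivity: a vertex missed by some maximum
  matching would otherwise not be related to itself.\<close>

definition not_both_missed :: "('a, 'b) pre_digraph \<Rightarrow> 'a set \<Rightarrow> 'a \<Rightarrow> 'a \<Rightarrow> bool" where
  "not_both_missed G W u v \<longleftrightarrow> u = v \<or> (\<forall>M. max_matching G W M \<longrightarrow> u \<in> \<Union>M \<or> v \<in> \<Union>M)"

context graph
begin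

section \<open>Edges, matchings and their sizes\<close>

lemma edges_subset_verts: "e \<in> edges G \<Longrightarrow> e \<subseteq> verts G"
  unfolding edges_def using adj_in_verts by blast

lemma edgesE:
  assumes "e \<in> edges G" "x \<in> e"
  obtains y where "e = {x, y}" "x \<noteq> y"
proof -
  obtain u v where uv: "e = {u, v}" "u \<rightarrow>\<^bsub>G\<^esub> v"
    using assms(1) unfolding edges_def by blast
  then have "u \<noteq> v" by (metis adj_not_same)
  then show thesis using that[of u] that[of v] uv assms(2) by auto
qed

lemma matching_finite:
  assumes "matching G M"
  shows "finite M" "finite (\<Union>M)"
proof -
  have "M \<subseteq> Pow (verts G)"
    using assms edges_subset_verts by (auto simp: matching_def)
  then show "finite M" "finite (\<Union>M)"
    using finite_subset[of M "Pow (verts G)"] finite_subset[of "\<Union>M" "verts G"] by auto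
qed

lemma card_Union_matching:
  assumes "matching G M"
  shows "card (\<Union>M) = 2 * card M"
proof -
  have two: "card e = 2" if "e \<in> M" for e
  proof -
    have e: "e \<in> edges G" using assms that by (auto simp: matching_def)
    then have "e \<noteq> {}" by (auto simp: edges_def)
    with e obtain x y where "e = {x, y}" "x \<noteq> y" using edgesE by (metis all_not_in_conv)
    then show ?thesis by simp
  qed
  have "card (\<Union>M) = sum card M"
  proof (rule card_Union_disjoint)
    show "pairwise disjnt M" using assms by (auto simp: matching_def pairwise_def disjnt_def)
    show "finite e" if "e \<in> M" for e
      using two[OF that] by (metis card.infinite zero_neq_numeral)
  qed
  then show ?thesis using two by simp
qed

lemma matching_insert:
  assumes "matching G M" "e \<in> edges G" "e \<inter> \<Union>M = {}"
  shows "matching G (insert e M)" "card (insert e M) = Suc (card M)"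
proof -
  show "matching G (insert e M)"
    using assms unfolding matching_def by blast
  \<comment> \<open>Edges are nonempty, so a member of \<open>M\<close> cannot be disjoint from
    \<open>\<Union>M\<close>.\<close>
  have "e \<notin> M" using assms(2,3) by (auto simp: edges_def)
  then show "card (insert e M) = Suc (card M)"
    using matching_finite[OF assms(1)] by simp
qed

lemma matching_diff: "matching G M \<Longrightarrow> matching G (M - A)"
  by (auto simp: matching_def)

lemma max_matching_exists: "\<exists>M. max_matching G W M"
proof -
  have "card M < Suc (card (verts G))" if "matching_within G W M" for M
  proof -
    have m: "matching G M" using that by (simp add: matching_within_def)
    then have "\<Union>M \<subseteq> verts G" using edges_subset_verts by (auto simp: matching_def)
    then have "card (\<Union>M) \<le> card (verts G)" by (simp add: card_mono)
    then show ?thesis using card_Union_matching[OF m] by simp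
  qed
  moreover have "matching_within G W {}" by (simp add: matching_within_def matching_def)
  ultimately show ?thesis
    using ex_has_greatest_nat[of "matching_within G W" "{}" card "Suc (card (verts G))"]
    unfolding max_matching_def by blast
qed

lemma max_matching_card_eq:
  "max_matching G W M \<Longrightarrow> max_matching G W N \<Longrightarrow> card M = card N"
  unfolding max_matching_def by (meson le_antisym)

text \<open>An edge with both ends missed could be added to the matching. Hence adjacent vertices of
  \<open>W\<close> are always related by \<open>not_both_missed\<close>.\<close>

lemma max_matching_not_both_missed:
  assumes "max_matching G W M" "u \<in> W" "v \<in> W" "{u, v} \<in> edges G"
  shows "u \<in> \<Union>M \<or> v \<in> \<Union>M"
proof (rule ccontr)
  assume "\<not> ?thesis"
  then have "{u, v} \<inter> \<Union>M = {}" by blast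
  moreover have "matching G M" using assms(1) by (simp add: max_matching_def matching_within_def)
  ultimately have "matching_within G W (insert {u, v} M)" "card (insert {u, v} M) = Suc (card M)"
    using matching_insert[of M "{u, v}"] assms
    by (auto simp: max_matching_def matching_within_def)
  then show False using assms(1) unfolding max_matching_def by (metis Suc_n_not_le_n)
qed

section \<open>The exchange argument of Gallai's lemma\<close>

text \<open>Let \<open>e = {x, y}\<close> be the edge of \<open>M\<close> at \<open>x\<close>.
  Maximality of \<open>N\<close> forces it to cover \<open>y\<close>, say by \<open>f\<close>, and
  replacing \<open>f\<close> by \<open>e\<close> keeps the size. Since \<open>f\<close> meets
  \<open>e\<close> in \<open>y\<close>, it is not in \<open>M\<close>, so one more edge is shared
  with \<open>M\<close>. The vertex \<open>t\<close> stays missed, being neither \<open>x\<close>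
  nor the covered vertex \<open>y\<close>.\<close>

lemma max_matching_exchange:
  assumes M: "max_matching G W M" and N: "max_matching G W N"
    and x: "x \<in> \<Union>M - \<Union>N" "x \<noteq> t" and t: "t \<notin> \<Union>N"
  obtains N' where "max_matching G W N'" "t \<notin> \<Union>N'" "card (M \<inter> N) < card (M \<inter> N')"
proof -
  have mM: "matching G M" "\<Union>M \<subseteq> W" and mN: "matching G N" "\<Union>N \<subseteq> W"
    using M N by (auto simp: max_matching_def matching_within_def)
  obtain e where e: "e \<in> M" "x \<in> e" using x by blast
  have eE: "e \<in> edges G" using e mM by (auto simp: matching_def)
  then obtain y where y: "e = {x, y}" "x \<noteq> y" using e edgesE by metis
  have "y \<in> \<Union>N"
    using max_matching_not_both_missed[OF N, of x y] x e y eE mM by auto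
  then obtain f where f: "f \<in> N" "y \<in> f" by blast
  have fe: "f \<noteq> e" using f e x by blast
  have "f \<inter> e \<noteq> {}" using f y by auto
  then have fM: "f \<notin> M" using e(1) fe mM(1) by (auto simp: matching_def)
  have eN: "e \<notin> N" using e x by blast
  define N' where "N' = insert e (N - {f})"
  have disj: "e \<inter> \<Union>(N - {f}) = {}"
  proof -
    have "y \<notin> g" if "g \<in> N - {f}" for g
      using that f mN(1) unfolding matching_def by (metis DiffE disjoint_iff singletonI)
    then show ?thesis using x y by auto
  qed
  have "matching G N'" "card N' = Suc (card (N - {f}))"
    unfolding N'_def using matching_insert[OF matching_diff[OF mN(1)] eE disj] by auto
  moreover have "Suc (card (N - {f})) = card N"
    using f matching_finite[OF mN(1)] by (metis card_Suc_Diff1)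
  moreover have "\<Union>N' \<subseteq> W" using mM mN e by (auto simp: N'_def)
  ultimately have "max_matching G W N'"
    using N by (auto simp: max_matching_def matching_within_def)
  moreover have "t \<notin> \<Union>N'" using t x y \<open>y \<in> \<Union>N\<close> by (auto simp: N'_def)
  moreover have "card (M \<inter> N) < card (M \<inter> N')"
  proof (rule psubset_card_mono)
    show "finite (M \<inter> N')" using matching_finite[OF mM(1)] by simp
    show "M \<inter> N \<subset> M \<inter> N'" using e eN fM by (auto simp: N'_def)
  qed
  ultimately show thesis using that by blast
qed

text \<open>If \<open>M\<close> misses both \<open>u\<close> and \<open>v\<close>, take among the
  maximum matchings missing \<open>t\<close> one that shares the most edges with \<open>M\<close>.
  The exchange lemma then produces one sharing still more.\<close>

lemma not_both_missed_trans:
  assumes ut: "not_both_missed G W u t" and tv: "not_both_missed G W t v"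
    and t: "\<exists>N. max_matching G W N \<and> t \<notin> \<Union>N"
  shows "not_both_missed G W u v"
proof (cases "u = t \<or> t = v \<or> u = v")
  case True
  then show ?thesis using ut tv by (auto simp: not_both_missed_def)
next
  case False
  show ?thesis
  proof (rule ccontr)
    assume "\<not> ?thesis"
    then obtain M where M: "max_matching G W M" "u \<notin> \<Union>M" "v \<notin> \<Union>M"
      by (auto simp: not_both_missed_def)
    have mM: "matching G M" using M by (auto simp: max_matching_def matching_within_def)
    let ?P = "\<lambda>N. max_matching G W N \<and> t \<notin> \<Union>N"
    have bnd: "card (M \<inter> N) < Suc (card M)" for N
      using matching_finite[OF mM] by (simp add: card_mono less_Suc_eq_le)
    obtain N0 where N0: "?P N0" using t by blast
    obtain N where N: "?P N" and best: "\<And>N'. ?P N' \<Longrightarrow> card (M \<inter> N') \<le> card (M \<inter> N)"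
      using ex_has_greatest_nat[of ?P N0 "\<lambda>N. card (M \<inter> N)" "Suc (card M)"] N0 bnd by blast
    have mN: "matching G N" using N by (auto simp: max_matching_def matching_within_def)
    \<comment> \<open>As \<open>N\<close> misses \<open>t\<close>, the relations of \<open>t\<close>
      to \<open>u\<close> and to \<open>v\<close> force \<open>N\<close> to cover both.\<close>
    have uv: "{u, v} \<subseteq> \<Union>N - \<Union>M"
      using ut tv N M False by (auto simp: not_both_missed_def)
    have fM: "finite (\<Union>M)" and fN: "finite (\<Union>N)" using matching_finite mM mN by auto
    \<comment> \<open>Both matchings cover equally many vertices, so \<open>M\<close> covers at
      least two vertices missed by \<open>N\<close>; one of them differs from \<open>t\<close> and
      can start the exchange.\<close>
    have "card (\<Union>M) = card (\<Union>N)"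
      using card_Union_matching mM mN max_matching_card_eq N M by metis
    moreover have "card (\<Union>M - \<Union>N) + card (\<Union>N) = card (\<Union>N - \<Union>M) + card (\<Union>M)"
      using card_Un_disjoint[of "\<Union>M - \<Union>N" "\<Union>N"] card_Un_disjoint[of "\<Union>N - \<Union>M" "\<Union>M"] fM fN
      by (simp add: Int_commute Un_commute)
    moreover have "2 \<le> card (\<Union>N - \<Union>M)"
      using card_mono[OF _ uv] fN False by simp
    ultimately have "\<not> \<Union>M - \<Union>N \<subseteq> {t}"
      using card_mono[of "{t}" "\<Union>M - \<Union>N"] by auto
    then obtain x where "x \<in> \<Union>M - \<Union>N" "x \<noteq> t" by blast
    then show False
      using max_matching_exchange[of W M N x t] M N best by (metis leD)
  qed
qed

section \<open>Deleting vertices and forming the classes\<close>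

text \<open>Removing the edge at \<open>v\<close> loses one edge. Nothing better is possible: a
  matching of \<open>W - {v}\<close> as large as \<open>M\<close> would be a maximum matching of
  \<open>W\<close> missing \<open>v\<close>.\<close>

lemma max_matching_delete_vertex:
  assumes M: "max_matching G W M" and v: "\<And>N. max_matching G W N \<Longrightarrow> v \<in> \<Union>N"
  obtains M' where "max_matching G (W - {v}) M'" "card M = Suc (card M')"
proof -
  have mM: "matching G M" "\<Union>M \<subseteq> W" using M by (auto simp: max_matching_def matching_within_def)
  obtain e where e: "e \<in> M" "v \<in> e" using v M by blast
  have card: "card M = Suc (card (M - {e}))"
    using e matching_finite[OF mM(1)] by (metis card_Suc_Diff1)
  have "v \<notin> \<Union>(M - {e})" using e mM unfolding matching_def by blast
  then have within: "matching_within G (W - {v}) (M - {e})"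
    using mM matching_diff[OF mM(1)] by (auto simp: matching_within_def)
  have "card N \<le> card (M - {e})" if N: "matching_within G (W - {v}) N" for N
  proof -
    have N': "matching_within G W N" "v \<notin> \<Union>N" using N by (auto simp: matching_within_def)
    then have "card N \<le> card M" using M by (auto simp: max_matching_def)
    moreover have "card N \<noteq> card M" using N' v M unfolding max_matching_def by metis
    ultimately show ?thesis using card by simp
  qed
  then show thesis using that within card by (auto simp: max_matching_def)
qed

text \<open>In a largest \<open>S\<close> whose deletion costs exactly one matching edge per vertex,
  no remaining vertex is covered by all maximum matchings, since it could be added to
  \<open>S\<close>.\<close>

lemma all_missable_subset:
  assumes "max_matching G (verts G) M0"
  obtains S M where "S \<subseteq> verts G" "max_matching G (verts G - S) M"
    "card M + card S = card M0"
    "\<And>v. v \<in> verts G - S \<Longrightarrow> \<exists>N. max_matching G (verts G - S) N \<and> v \<notin> \<Union>N"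
proof -
  let ?P = "\<lambda>S. S \<subseteq> verts G \<and> (\<exists>M. max_matching G (verts G - S) M \<and> card M + card S = card M0)"
  have "?P {}" using assms by auto
  moreover have "card S < Suc (card (verts G))" if "?P S" for S
    using that by (simp add: card_mono less_Suc_eq_le)
  ultimately obtain S where S: "?P S" and best: "\<And>T. ?P T \<Longrightarrow> card T \<le> card S"
    using ex_has_greatest_nat[of ?P "{}" card "Suc (card (verts G))"] by blast
  obtain M where M: "max_matching G (verts G - S) M" "card M + card S = card M0" using S by blast
  have "\<exists>N. max_matching G (verts G - S) N \<and> v \<notin> \<Union>N" if v: "v \<in> verts G - S" for v
  proof (rule ccontr)
    assume "\<not> ?thesis"
    then obtain M' where M': "max_matching G (verts G - S - {v}) M'" "card M = Suc (card M')"
      using max_matching_delete_vertex[OF M(1)] by blast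
    have "verts G - insert v S = verts G - S - {v}" by blast
    moreover have "finite S" using S finite_subset finite_verts by blast
    then have "card (insert v S) = Suc (card S)" using v by simp
    ultimately have "?P (insert v S)" using M M' S v by auto
    then show False using best[of "insert v S"] \<open>card (insert v S) = Suc (card S)\<close> by simp
  qed
  then show thesis using that S M by blast
qed

lemma no_perfect_matching_partition:
  assumes "\<nexists>M. perfect_matching G M" and "even (card (verts G))"
  obtains S \<P> where "S \<subseteq> verts G" "partition_on (verts G - S) \<P>" "card S + 2 \<le> card \<P>"
    "\<And>P Q u v. P \<in> \<P> \<Longrightarrow> Q \<in> \<P> \<Longrightarrow> P \<noteq> Q \<Longrightarrow> u \<in> P \<Longrightarrow> v \<in> Q \<Longrightarrow> {u, v} \<notin> edges G"
proof -
  obtain M0 where M0: "max_matching G (verts G) M0" using max_matching_exists by blast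
  obtain S M where S: "S \<subseteq> verts G" and M: "max_matching G (verts G - S) M"
    and cM: "card M + card S = card M0"
    and miss: "\<And>v. v \<in> verts G - S \<Longrightarrow> \<exists>N. max_matching G (verts G - S) N \<and> v \<notin> \<Union>N"
    using all_missable_subset[OF M0] by blast
  define W where "W = verts G - S"
  define r where "r = {(u, v). u \<in> W \<and> v \<in> W \<and> not_both_missed G W u v}"
  have r: "equiv W r"
  proof (rule equivI)
    show "r \<subseteq> W \<times> W" by (auto simp: r_def)
    show "refl_on W r" by (auto simp: r_def refl_on_def not_both_missed_def)
    show "sym r" by (auto simp: r_def sym_def not_both_missed_def)
    \<comment> \<open>The middle vertex lies in \<open>W\<close>, so \<open>miss\<close> supplies
      the maximum matching that avoids it.\<close>
    show "trans r"
      using not_both_missed_trans miss unfolding r_def W_def trans_def by blast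
  qed
  have fW: "finite W" by (simp add: W_def)
  have mM0: "matching G M0" "\<Union>M0 \<subseteq> verts G" and mM: "matching G M" "\<Union>M \<subseteq> W"
    using M0 M by (auto simp: max_matching_def matching_within_def W_def)
  have "\<not> verts G \<subseteq> \<Union>M0"
    using assms(1) mM0 by (auto simp: perfect_matching_def)
  then have "\<Union>M0 \<subset> verts G" using mM0 by blast
  then have "2 * card M0 < card (verts G)"
    using psubset_card_mono[of "verts G" "\<Union>M0"] card_Union_matching[OF mM0(1)] by simp
  \<comment> \<open>Both sides of the strict inequality are even, so they differ by at least
    2.\<close>
  then have "2 * card M0 + 2 \<le> card (verts G)" using assms(2) by (elim evenE) simp
  moreover have "card W + card S = card (verts G)"
    using S card_Diff_subset[of S "verts G"] card_mono[of "verts G" S] finite_subset[OF S]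
    by (simp add: W_def)
  moreover have "card (W - \<Union>M) + 2 * card M = card W"
    using mM card_Diff_subset[of "\<Union>M" W] card_mono[OF fW mM(2)] card_Union_matching[OF mM(1)]
      matching_finite[OF mM(1)] by simp
  \<comment> \<open>With \<open>n\<close> the number of vertices, the missed vertices number
    \<open>n - card S - 2 * (card M0 - card S)\<close>, which is
    \<open>(n - 2 * card M0) + card S\<close>.\<close>
  ultimately have missed: "card S + 2 \<le> card (W - \<Union>M)" using cM by linarith
  \<comment> \<open>\<open>M\<close> itself witnesses that two distinct vertices it misses are
    unrelated.\<close>
  have "inj_on (\<lambda>v. r `` {v}) (W - \<Union>M)"
  proof (rule inj_onI)
    fix u v assume u: "u \<in> W - \<Union>M" and v: "v \<in> W - \<Union>M" and "r `` {u} = r `` {v}"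
    then have "(u, v) \<in> r" using eq_equiv_class[OF _ r] by blast
    then show "u = v" using u v M by (auto simp: r_def not_both_missed_def W_def)
  qed
  moreover have "(\<lambda>v. r `` {v}) ` (W - \<Union>M) \<subseteq> W // r" by (auto intro: quotientI)
  moreover have "finite (W // r)" using fW r by (simp add: finite_quotient equiv_type)
  ultimately have "card (W - \<Union>M) \<le> card (W // r)" by (rule card_inj_on_le)
  then have "card S + 2 \<le> card (W // r)" using missed by simp
  moreover have "{u, v} \<notin> edges G"
    if PQ: "P \<in> W // r" "Q \<in> W // r" "P \<noteq> Q" "u \<in> P" "v \<in> Q" for P Q u v
  proof
    assume e: "{u, v} \<in> edges G"
    have "u \<in> W" "v \<in> W" using PQ in_quotient_imp_subset[OF r] by auto
    then have "(u, v) \<in> r"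
      using max_matching_not_both_missed[OF _ _ _ e] by (auto simp: r_def not_both_missed_def)
    then show False using PQ quotient_eqI[OF r, of P Q u v] by blast
  qed
  ultimately show thesis
    using that[of S "W // r"] S partition_on_quotient[OF r] by (simp add: W_def)
qed

section \<open>Expansion\<close>

text \<open>Condition (b) makes one side of every division of the classes small. A large class
  leaves few vertices outside it, to which (a) applies; without one, the classes together cover less
  than half of the vertices.\<close>

lemma expander_partition_card:
  assumes C: "C \<ge> 3" and G: "expander C G"
    and S: "S \<subseteq> verts G" and part: "partition_on (verts G - S) \<P>"
    and two: "2 \<le> card \<P>"
    and sep: "\<And>P Q u v. P \<in> \<P> \<Longrightarrow> Q \<in> \<P> \<Longrightarrow> P \<noteq> Q \<Longrightarrow> u \<in> P \<Longrightarrow> v \<in> Q \<Longrightarrow> {u, v} \<notin> edges G"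
  shows "card \<P> \<le> card S"
proof (rule ccontr)
  assume "\<not> ?thesis"
  then have big: "card S < card \<P>" by simp
  define n where "n = real (card (verts G))"
  define m where "m = n / (2 * C)"
  have grow: "C * real (card X) \<le> real (card (neighbourhood G X))"
    if "X \<subseteq> verts G" "1 \<le> card X" "real (card X) \<le> m" for X
    using G that by (auto simp: expander_def m_def n_def)
  have join: "\<exists>a\<in>A. \<exists>b\<in>B. {a, b} \<in> edges G"
    if "A \<subseteq> verts G" "B \<subseteq> verts G" "A \<inter> B = {}" "m \<le> real (card A)" "m \<le> real (card B)" for A B
    using G that by (auto simp: expander_def m_def n_def)
  have U: "\<Union>\<P> = verts G - S" and ne: "{} \<notin> \<P>" and dis: "disjoint \<P>"
    using part by (auto simp: partition_on_def)
  have finP: "finite \<P>" using two by (metis card.infinite not_numeral_le_zero)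
  have sub: "\<Union>\<Q> \<subseteq> verts G" if "\<Q> \<subseteq> \<P>" for \<Q> using U that by blast
  have finU: "finite (\<Union>\<Q>)" if "\<Q> \<subseteq> \<P>" for \<Q> by (rule finite_subset[OF sub[OF that] finite_verts])
  \<comment> \<open>Classes are disjoint and nonempty, so each contributes at least one
    vertex.\<close>
  have cle: "card \<Q> \<le> card (\<Union>\<Q>)" if Q: "\<Q> \<subseteq> \<P>" for \<Q>
  proof -
    have "card (\<Union>\<Q>) = sum card \<Q>"
    proof (rule card_Union_disjoint)
      show "pairwise disjnt \<Q>" using dis Q pairwise_subset by auto
      show "finite P" if "P \<in> \<Q>" for P
        using finU[OF Q] that by (meson Union_upper finite_subset)
    qed
    moreover have "1 \<le> card P" if "P \<in> \<Q>" for P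
    proof -
      have "finite P" using finU[OF Q] that by (meson Union_upper finite_subset)
      moreover have "P \<noteq> {}" using ne Q that by blast
      ultimately show ?thesis by (simp add: Suc_le_eq card_gt_0_iff)
    qed
    then have "sum (\<lambda>_. 1) \<Q> \<le> sum card \<Q>" by (intro sum_mono)
    ultimately show ?thesis by simp
  qed
  have disU: "\<Union>\<Q> \<inter> \<Union>(\<P> - \<Q>) = {}" if "\<Q> \<subseteq> \<P>" for \<Q>
  proof -
    have "P \<inter> Q = {}" if "P \<in> \<Q>" "Q \<in> \<P> - \<Q>" for P Q
      using disjointD[OF dis, of P Q] that \<open>\<Q> \<subseteq> \<P>\<close> by auto
    then show ?thesis by auto
  qed
  \<comment> \<open>Two unions of size at least \<open>m\<close> would be joined by an edge, and its
    ends would lie in different classes.\<close>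
  have split: "real (card (\<Union>\<Q>)) < m \<or> real (card (\<Union>(\<P> - \<Q>))) < m" if Q: "\<Q> \<subseteq> \<P>" for \<Q>
  proof (rule ccontr)
    assume "\<not> ?thesis"
    then have "m \<le> real (card (\<Union>\<Q>))" "m \<le> real (card (\<Union>(\<P> - \<Q>)))" by simp_all
    from join[OF sub[OF Q] sub[OF Diff_subset] disU[OF Q] this]
    obtain P P' a b where P: "P \<in> \<Q>" "a \<in> P" and P': "P' \<in> \<P> - \<Q>" "b \<in> P'"
      and ab: "{a, b} \<in> edges G"
      by blast
    have "P \<in> \<P>" "P' \<in> \<P>" "P \<noteq> P'" using P P' Q by auto
    then show False using sep P P' ab by metis
  qed
  have csum: "card (\<Union>\<Q>) + card (\<Union>(\<P> - \<Q>)) = card (\<Union>\<P>)" if Q: "\<Q> \<subseteq> \<P>" for \<Q>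
  proof -
    have "\<Union>\<P> = \<Union>\<Q> \<union> \<Union>(\<P> - \<Q>)" using Q by blast
    then show ?thesis
      using card_Un_disjoint[OF finU[OF Q] finU disU[OF Q]] by auto
  qed
  show False
  proof (cases "\<exists>P\<in>\<P>. m \<le> real (card P)")
    case True
    then obtain P where P: "P \<in> \<P>" "m \<le> real (card P)" by blast
    let ?X = "\<Union>(\<P> - {P})"
    have small: "real (card ?X) < m" using split[of "{P}"] P by auto
    have cX: "card \<P> - 1 \<le> card ?X" using cle[of "\<P> - {P}"] P finP by auto
    have "neighbourhood G ?X \<subseteq> S"
    proof
      fix v assume "v \<in> neighbourhood G ?X"
      then obtain u where v: "v \<in> verts G" "v \<notin> ?X" and u: "u \<in> ?X" "{u, v} \<in> edges G"
        by (auto simp: neighbourhood_def)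
      obtain Q where "Q \<in> \<P>" "Q \<noteq> P" "u \<in> Q" using u by blast
      then have "v \<notin> P" using sep[of Q P u v] u P by blast
      then show "v \<in> S" using v U by blast
    qed
    then have "card (neighbourhood G ?X) \<le> card S"
      using card_mono finite_subset[OF S] by simp
    moreover have "C * real (card ?X) \<le> real (card (neighbourhood G ?X))"
      using grow[OF sub] small cX two by auto
    \<comment> \<open>Now \<open>3 * card ?X \<le> card S \<le> card \<P> - 1 \<le> card ?X\<close>,
      whereas \<open>?X\<close> is nonempty because there are at least two classes.\<close>
    moreover have "3 * real (card ?X) \<le> C * real (card ?X)" using C by (intro mult_right_mono) auto
    ultimately show False using cX big two by linarith
  next
    case False
    have "\<P> \<noteq> {}" using two by auto
    then have n: "0 < n"
      using ne U by (auto simp: n_def card_gt_0_iff)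
    then have m0: "0 < m" using C by (simp add: m_def)
    have m6: "6 * m \<le> n" using C n by (simp add: m_def field_simps)
    \<comment> \<open>A small union with the most classes is chosen; the empty family qualifies
      since \<open>m\<close> is positive. Adding any further class makes the union reach
      \<open>m\<close>, so by \<open>split\<close> the rest is small.\<close>
    let ?P = "\<lambda>\<Q>. \<Q> \<subseteq> \<P> \<and> real (card (\<Union>\<Q>)) < m"
    have "card \<Q> < Suc (card \<P>)" if "?P \<Q>" for \<Q>
      using that finP by (simp add: card_mono less_Suc_eq_le)
    moreover have "?P {}" using m0 by simp
    ultimately obtain \<Q> where Q: "?P \<Q>" and best: "\<And>\<R>. ?P \<R> \<Longrightarrow> card \<R> \<le> card \<Q>"
      using ex_has_greatest_nat[of ?P "{}" card "Suc (card \<P>)"] by blast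
    have "real (card (\<Union>\<P>)) < 3 * m"
    proof (cases "\<Q> = \<P>")
      case True
      then show ?thesis using Q m0 by simp
    next
      case neq: False
      then obtain P where P: "P \<in> \<P>" "P \<notin> \<Q>" using Q by blast
      let ?R = "insert P \<Q>"
      have R: "?R \<subseteq> \<P>" using P Q by blast
      have "finite \<Q>" using Q finP finite_subset by blast
      then have "\<not> card ?R \<le> card \<Q>" using P by simp
      then have "m \<le> real (card (\<Union>?R))" using best[of ?R] R by linarith
      then have "real (card (\<Union>(\<P> - ?R))) < m" using split[OF R] by linarith
      \<comment> \<open>All classes are thus divided into \<open>\<Q>\<close>, the single class
        \<open>P\<close> and the rest, each covering fewer than \<open>m\<close> vertices.\<close>
      moreover have "card (\<Union>?R) \<le> card P + card (\<Union>\<Q>)" by (simp add: card_Un_le)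
      moreover have "real (card P) < m" using False P by auto
      ultimately show ?thesis using csum[OF R] Q by linarith
    qed
    moreover have "real (card (\<Union>\<P>)) + real (card S) = n"
      unfolding U n_def
      using S card_Diff_subset[of S "verts G"] card_mono[of "verts G" S] finite_subset[OF S] by simp
    moreover have "card \<P> \<le> card (\<Union>\<P>)" using cle by blast
    \<comment> \<open>From \<open>3 * m \<le> n / 2\<close> it follows that \<open>S\<close> has
      more than \<open>n / 2\<close> vertices and the classes number fewer, against
      \<open>big\<close>.\<close>
    ultimately show False using big m6 by linarith
  qed
qed

end

theorem lemma4p1:
  fixes G :: "('a, 'b) pre_digraph" and C :: real
  assumes "graph G"
    and "C \<ge> 3"
    and "expander C G"
    and "even (card (verts G))"
  shows "\<exists>M. perfect_matching G M"
proof (rule ccontr)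
  interpret graph G by (fact assms(1))
  assume "\<nexists>M. perfect_matching G M"
  then obtain S \<P> where "S \<subseteq> verts G" "partition_on (verts G - S) \<P>" and "card S + 2 \<le> card \<P>"
    and "\<And>P Q u v. P \<in> \<P> \<Longrightarrow> Q \<in> \<P> \<Longrightarrow> P \<noteq> Q \<Longrightarrow> u \<in> P \<Longrightarrow> v \<in> Q \<Longrightarrow> {u, v} \<notin> edges G"
    using no_perfect_matching_partition assms(4) by metis
  then have "card \<P> \<le> card S"
    by (intro expander_partition_card[OF assms(2,3)]) auto
  then show False using \<open>card S + 2 \<le> card \<P>\<close> by simp
qed

end
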